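(* Let $A$ be a finite alphabet and $F$ a cellular automaton of radius $r$ acting on $A^{\mathbb{Z}^2}$. For every integer $n\ge r$ one has $h(\mathcal{S}_n,F)=h(\mathcal{S}'_n,F)$, and for every $n\in\mathbb{N}$ one has $ER(\mathcal{S}_n,F)=ER(\mathcal{S}_0,F)$. Moreover, for all $k\in\mathbb{N}$, $$ER(\mathcal{S}_k,F)=ER(\mathcal{S}_0,F)\le 8r\log(\#A).$$
   Context: $A^{\mathbb{Z}^2}$ carries the product of discrete topologies. The shifts are $\sigma^v(x)_u=x_{u+v}$, $u,v\in\mathbb{Z}^2$. Let $E_n=\{(i,j)\in\mathbb{Z}^2: -n\le i,j\le n\}$. A cellular automaton (CA) $F$ is a continuous self-map of $A^{\mathbb{Z}^2}$ commuting with all shifts; equivalently there are $r\in\mathbb{N}$ and $f:A^{E_r}\to A$ with $F(x)_z=f\big((x_{z+u})_{u\in E_r}\big)$ for all $z$; such an $r$ is called the radius of $F$. For $n\ge r$, $E'_n=E_n\setminus E_{n-r}$. For a finite open cover $\mathcal{C}$, $\mathcal{C}_n=\bigvee_{v\in E_n}\sigma^v(\mathcal{C})$ and $\mathcal{C}'_n=\bigvee_{v\in E'_n}\sigma^v(\mathcal{C})$. $\mathcal{S}_0$ is the clopen partition (viewed as an open cover) according to the coordinate at $(0,0)$; $\mathcal{S}_n=(\mathcal{S}_0)_n$, $\mathcal{S}'_n=(\mathcal{S}_0)'_n$. For an open cover $\mathcal{U}$, $H(\mathcal{U})=\ln N(\mathcal{U})$ with $N(\mathcal{U})$ the smallest cardinality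 of a subcover; $h(\mathcal{U},F)=\lim_{N\to\infty}\frac1N H(\bigvee_{i=0}^{N-1}F^{-i}\mathcal{U})$; and $ER(\mathcal{C},F)=\limsup_{n\to\infty}\frac1n h(\mathcal{C}'_n,F)$. Logarithms are natural. *)

theory Defs
  imports "HOL-Analysis.Analysis"
begin

type_synonym 'a config = "int \<times> int \<Rightarrow> 'a"

definition config_topology :: "'a config topology" where
  "config_topology = product_topology (\<lambda>_. discrete_topology UNIV) UNIV"

definition shift :: "int \<times> int \<Rightarrow> 'a config \<Rightarrow> 'a config" where
  "shift v x = (\<lambda>u. x (u + v))"

definition box :: "nat \<Rightarrow> (int \<times> int) set" where
  "box n = {- int n..int n} \<times> {- int n..int n}"

text \<open>Only meaningful for \<open>n \<ge> r\<close>; for smaller \<open>n\<close> the subtraction truncates.\<close>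

definition ring_box :: "nat \<Rightarrow> nat \<Rightarrow> (int \<times> int) set" where
  "ring_box r n = box n - box (n - r)"

definition cellular_automaton :: "('a config \<Rightarrow> 'a config) \<Rightarrow> bool" where
  "cellular_automaton F \<longleftrightarrow>
     continuous_map config_topology config_topology F \<and>
     (\<forall>v x. F (shift v x) = shift v (F x))"

text \<open>The local rule \<open>f\<close> only sees the pattern of \<open>x\<close> on \<open>z + box r\<close>, since its
  argument is restricted to \<open>box r\<close>. A radius need not be minimal.\<close>

definition has_radius :: "('a config \<Rightarrow> 'a config) \<Rightarrow> nat \<Rightarrow> bool" where
  "has_radius F r \<longleftrightarrow>
     (\<exists>f. \<forall>x z. F x z = f (restrict (\<lambda>u. x (z + u)) (box r)))"

text \<open>The join over an empty index set is the trivial cover \<open>{UNIV}\<close>. A join may contain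
  the empty set as a member, which does not affect the size of a smallest subcover.\<close>

definition cover_join :: "'i set \<Rightarrow> ('i \<Rightarrow> 'x set set) \<Rightarrow> 'x set set" where
  "cover_join I C = {\<Inter>i\<in>I. U i | U. \<forall>i\<in>I. U i \<in> C i}"

definition shift_cover :: "int \<times> int \<Rightarrow> 'a config set set \<Rightarrow> 'a config set set" where
  "shift_cover v C = (\<lambda>U. shift v ` U) ` C"

definition box_cover :: "'a config set set \<Rightarrow> nat \<Rightarrow> 'a config set set" where
  "box_cover C n = cover_join (box n) (\<lambda>v. shift_cover v C)"

definition ring_cover :: "nat \<Rightarrow> 'a config set set \<Rightarrow> nat \<Rightarrow> 'a config set set" where
  "ring_cover r C n = cover_join (ring_box r n) (\<lambda>v. shift_cover v C)"

definition origin_partition :: "'a config set set" where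
  "origin_partition = range (\<lambda>a. {x. x (0, 0) = a})"

definition min_subcover_card :: "'x set set \<Rightarrow> nat" where
  "min_subcover_card C =
     (LEAST m. \<exists>V \<subseteq> C. finite V \<and> \<Union>V = UNIV \<and> card V = m)"

definition cover_entropy :: "'x set set \<Rightarrow> real" where
  "cover_entropy C = ln (real (min_subcover_card C))"

definition preimage_cover :: "('x \<Rightarrow> 'x) \<Rightarrow> 'x set set \<Rightarrow> 'x set set" where
  "preimage_cover g C = (\<lambda>U. g -` U) ` C"

text \<open>For covers with a finite subcover the limit exists by subadditivity.\<close>

definition dyn_entropy :: "'x set set \<Rightarrow> ('x \<Rightarrow> 'x) \<Rightarrow> real" where
  "dyn_entropy C F =
     lim (\<lambda>N. cover_entropy (cover_join {..<N} (\<lambda>i. preimage_cover (F ^^ i) C)) / real N)"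

text \<open>The limit superior is taken in the extended reals. The value depends on the chosen
  radius \<open>r\<close> through the rings.\<close>

definition entropy_rate ::
    "nat \<Rightarrow> 'a config set set \<Rightarrow> ('a config \<Rightarrow> 'a config) \<Rightarrow> ereal" where
  "entropy_rate r C F = limsup (\<lambda>n. ereal (dyn_entropy (ring_cover r C n) F / real n))"

end

theory Submission
  imports Defs
begin

text \<open>
  All covers involved are, up to the empty set, partitions by agreement on a finite set of cells
  \<open>D\<close>, so entropies count the \<open>D\<close>-traces of orbits. The next state of the inner box \<open>E\<^bsub>n-r\<^esub>\<close>
  only depends on \<open>E\<^sub>n\<close>; hence a trace on \<open>E\<^sub>n\<close> is determined by its trace on the ring \<open>E\<^sub>n'\<close>
  together with the initial pattern on \<open>E\<^sub>n\<close>, which contributes a factor independent of time.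
  For the second claim, the cells seen by \<open>(\<S>\<^sub>k)\<^sub>n'\<close> lie between \<open>E\<^sub>n'\<close> and \<open>E\<^bsub>n+k\<^esub>\<close>, and
  the entropy on \<open>E\<^bsub>n+k\<^esub>\<close> equals the one on \<open>E\<^bsub>n+k\<^esub>'\<close>. The bound counts the at most \<open>8rn\<close>
  cells of \<open>E\<^sub>n'\<close>.
\<close>

section \<open>Covers induced by equivalence relations\<close>

text \<open>The empty set is discarded because a join of partitions may contain empty intersections;
  the remaining members are exactly the classes of \<open>e\<close>.\<close>

definition induces :: "'x set set \<Rightarrow> ('x \<Rightarrow> 'x \<Rightarrow> bool) \<Rightarrow> bool" where
  "induces C e \<longleftrightarrow> equivp e \<and> C - {{}} = range (\<lambda>x. Collect (e x))"

lemma inducesD: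
  assumes "induces C e"
  shows "e x x" "Collect (e x) \<in> C" "U \<in> C \<Longrightarrow> x \<in> U \<Longrightarrow> U = Collect (e x)"
proof -
  have eq: "equivp e" and C: "C - {{}} = range (\<lambda>x. Collect (e x))"
    using assms by (auto simp: induces_def)
  show "e x x" by (rule equivp_reflp[OF eq])
  show "Collect (e x) \<in> C" using C by blast
  assume "U \<in> C" "x \<in> U"
  then have "U \<in> range (\<lambda>x. Collect (e x))" using C by blast
  then obtain y where y: "U = Collect (e y)" by blast
  with \<open>x \<in> U\<close> have "e y x" by simp
  then have "e y = e x" using eq by (simp add: equivp_def)
  with y show "U = Collect (e x)" by simp
qed

lemma inducesI:
  assumes "equivp e" "\<And>x. Collect (e x) \<in> C"
    and "\<And>U x. U \<in> C \<Longrightarrow> x \<in> U \<Longrightarrow> U = Collect (e x)"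
  shows "induces C e"
  unfolding induces_def
proof (intro conjI assms(1) equalityI subsetI)
  fix U assume "U \<in> C - {{}}"
  then obtain x where "U \<in> C" "x \<in> U" by blast
  with assms(3) show "U \<in> range (\<lambda>x. Collect (e x))" by blast
next
  fix U assume "U \<in> range (\<lambda>x. Collect (e x))"
  then obtain x where x: "U = Collect (e x)" by blast
  have "x \<in> U" using x equivp_reflp[OF assms(1)] by simp
  with x assms(2) show "U \<in> C - {{}}" by blast
qed

text \<open>Any point of a nonempty intersection forces each factor to be the class of that point,
  so the classes of the join are the intersections of classes.\<close>

lemma induces_cover_join:
  assumes "\<And>i. i \<in> I \<Longrightarrow> induces (C i) (e i)"
  shows "induces (cover_join I C) (\<lambda>x y. \<forall>i\<in>I. e i x y)"
proof (rule inducesI)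
  have "equivp (e i)" if "i \<in> I" for i using assms[OF that] by (simp add: induces_def)
  then show "equivp (\<lambda>x y. \<forall>i\<in>I. e i x y)"
    unfolding equivp_reflp_symp_transp reflp_def symp_def transp_def by blast
next
  fix x
  have "{y. \<forall>i\<in>I. e i x y} = (\<Inter>i\<in>I. Collect (e i x))" by auto
  moreover have "\<forall>i\<in>I. Collect (e i x) \<in> C i" using inducesD(2)[OF assms] by blast
  ultimately show "{y. \<forall>i\<in>I. e i x y} \<in> cover_join I C"
    unfolding cover_join_def by blast
next
  fix W x assume "W \<in> cover_join I C" "x \<in> W"
  then obtain U where U: "W = (\<Inter>i\<in>I. U i)" "\<forall>i\<in>I. U i \<in> C i"
    unfolding cover_join_def by blast
  have "U i = Collect (e i x)" if "i \<in> I" for i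
    using inducesD(3)[OF assms[OF that]] U that \<open>x \<in> W\<close> by blast
  with U(1) show "W = {y. \<forall>i\<in>I. e i x y}" by auto
qed

lemma induces_preimage_cover:
  assumes "induces C e"
  shows "induces (preimage_cover g C) (\<lambda>x y. e (g x) (g y))"
proof (rule inducesI)
  have "e a b \<longleftrightarrow> e a = e b" for a b
    using assms by (simp add: induces_def equivp_def)
  then show "equivp (\<lambda>x y. e (g x) (g y))"
    by (intro equivpI reflpI sympI transpI) simp_all
next
  fix x
  have "{y. e (g x) (g y)} = g -` Collect (e (g x))" by auto
  then show "{y. e (g x) (g y)} \<in> preimage_cover g C"
    using inducesD(2)[OF assms] unfolding preimage_cover_def by blast
next
  fix W x assume "W \<in> preimage_cover g C" "x \<in> W"
  then obtain U where U: "W = g -` U" "U \<in> C" unfolding preimage_cover_def by blast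
  then have "U = Collect (e (g x))" using inducesD(3)[OF assms] \<open>x \<in> W\<close> by blast
  with U show "W = {y. e (g x) (g y)}" by auto
qed

text \<open>A partition has no proper subcover: the class of \<open>x\<close> is the only member
  containing \<open>x\<close>. Since \<open>g\<close> labels the classes injectively, counting them
  means counting the values of \<open>g\<close>.\<close>

lemma min_subcover_card_induces:
  assumes "induces C e" and e: "\<And>x y. e x y \<longleftrightarrow> g x = g y" and fin: "finite (range g)"
  shows "min_subcover_card C = card (range g)"
proof -
  let ?P = "range (\<lambda>x. Collect (e x))"
  have "Collect (e x) = g -` {g x}" for x by (auto simp: e)
  then have P: "?P = (\<lambda>t. g -` {t}) ` range g" by (simp add: image_image)
  have inj: "inj_on (\<lambda>t. g -` {t}) (range g)"
  proof (rule inj_onI)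
    fix s t assume "s \<in> range g" and st: "g -` {s} = g -` {t}"
    then obtain x where "s = g x" by blast
    with st have "x \<in> g -` {t}" by blast
    with \<open>s = g x\<close> show "s = t" by simp
  qed
  have cP: "card ?P = card (range g)" unfolding P by (rule card_image[OF inj])
  have fP: "finite ?P" unfolding P using fin by simp
  show ?thesis unfolding min_subcover_card_def
  proof (rule Least_equality)
    have "?P \<subseteq> C" by (intro image_subsetI inducesD(2)[OF assms(1)])
    moreover have "\<Union> ?P = UNIV" using inducesD(1)[OF assms(1)] by auto
    ultimately show "\<exists>V\<subseteq>C. finite V \<and> \<Union> V = UNIV \<and> card V = card (range g)"
      using fP cP by blast
  next
    fix m assume "\<exists>V\<subseteq>C. finite V \<and> \<Union> V = UNIV \<and> card V = m"
    then obtain V where V: "V \<subseteq> C" "finite V" "\<Union> V = UNIV" "card V = m" by blast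
    have "Collect (e x) \<in> V" for x
    proof -
      have "x \<in> \<Union> V" using V(3) by simp
      then obtain U where U: "U \<in> V" "x \<in> U" by (rule UnionE)
      then have "U = Collect (e x)" by (intro inducesD(3)[OF assms(1) subsetD[OF V(1)]])
      with U(1) show ?thesis by simp
    qed
    then have "?P \<subseteq> V" by (intro image_subsetI)
    then have "card ?P \<le> card V" by (rule card_mono[OF V(2)])
    then show "card (range g) \<le> m" by (simp only: V(4) cP)
  qed
qed

section \<open>Covers by agreement on a set of cells\<close>

abbreviation agree_on :: "(int \<times> int) set \<Rightarrow> 'a config \<Rightarrow> 'a config \<Rightarrow> bool" where
  "agree_on D \<equiv> \<lambda>x y. \<forall>u\<in>D. x u = y u"

lemma induces_agree_on_join:
  assumes "\<And>i. i \<in> I \<Longrightarrow> induces (C i) (agree_on (D i))"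
  shows "induces (cover_join I C) (agree_on (\<Union>i\<in>I. D i))"
proof -
  have "(\<lambda>x y. \<forall>i\<in>I. agree_on (D i) x y) = agree_on (\<Union>i\<in>I. D i)" by auto
  with induces_cover_join[OF assms] show ?thesis by simp
qed

lemma induces_origin_partition: "induces origin_partition (agree_on {(0, 0)})"
proof (rule inducesI)
  show "equivp (agree_on {(0, 0)})" by (intro equivpI reflpI sympI transpI) auto
  show "Collect (agree_on {(0, 0)} x) \<in> origin_partition" for x :: "'a config"
    unfolding origin_partition_def by (rule range_eqI[of _ _ "x (0, 0)"]) auto
  show "U = Collect (agree_on {(0, 0)} x)"
    if "U \<in> origin_partition" "x \<in> U" for U and x :: "'a config"
    using that unfolding origin_partition_def by auto
qed

text \<open>Shifts are invertible, so the image under \<open>shift v\<close> is the preimage under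
  \<open>shift (- v)\<close>, which turns the cell \<open>u\<close> into
  \<open>u - v\<close>.\<close>

lemma induces_shift_cover:
  assumes "induces C (agree_on D)"
  shows "induces (shift_cover v C) (agree_on ((\<lambda>u. u - v) ` D))"
proof -
  have "shift v ` U = shift (- v) -` U" for U :: "'a config set"
  proof (intro equalityI subsetI)
    fix x assume "x \<in> shift (- v) -` U"
    moreover have "x = shift v (shift (- v) x)" by (simp add: shift_def)
    ultimately show "x \<in> shift v ` U" by blast
  qed (auto simp: shift_def)
  then have "shift_cover v C = preimage_cover (shift (- v)) C"
    by (simp add: shift_cover_def preimage_cover_def)
  moreover have eq: "(\<lambda>x y. agree_on D (shift (- v) x) (shift (- v) y)) =
      agree_on ((\<lambda>u. u - v) ` D)"
    by (auto simp: shift_def)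
  have "induces (preimage_cover (shift (- v)) C) (agree_on ((\<lambda>u. u - v) ` D))"
    by (rule subst[OF eq, of "induces _"]) (rule induces_preimage_cover[OF assms])
  ultimately show ?thesis by simp
qed

lemma induces_shift_join:
  assumes "induces C (agree_on D)"
  shows "induces (cover_join I (\<lambda>v. shift_cover v C)) (agree_on (\<Union>v\<in>I. (\<lambda>u. u - v) ` D))"
  by (intro induces_agree_on_join induces_shift_cover assms)

lemma uminus_box: "v \<in> box n \<longleftrightarrow> - v \<in> box n"
  by (cases v) (auto simp: box_def)

lemma uminus_ring_box: "v \<in> ring_box r n \<longleftrightarrow> - v \<in> ring_box r n"
  using uminus_box unfolding ring_box_def by blast

text \<open>Shifting the origin partition by \<open>v\<close> reads the cell \<open>- v\<close>, so
  a join over \<open>I\<close> reads the reflection of \<open>I\<close>. Boxes and rings are their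
  own reflections.\<close>

lemma reflect_symmetric:
  fixes I :: "(int \<times> int) set"
  assumes "\<And>v. v \<in> I \<longleftrightarrow> - v \<in> I"
  shows "(\<Union>v\<in>I. (\<lambda>u. u - v) ` {(0, 0)}) = I"
proof -
  have "(0, 0) - v = - v" for v :: "int \<times> int" by (cases v) simp
  then have "(\<Union>v\<in>I. (\<lambda>u. u - v) ` {(0, 0)}) = uminus ` I" by auto
  also have "\<dots> = I"
  proof (intro equalityI subsetI)
    fix v assume "v \<in> I"
    then have "- v \<in> I" using assms by blast
    then show "v \<in> uminus ` I" by (rule rev_image_eqI) simp
  qed (use assms in auto)
  finally show ?thesis .
qed

lemma induces_box_cover: "induces (box_cover origin_partition n) (agree_on (box n))"
  using induces_shift_join[OF induces_origin_partition, of "box n"]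
  unfolding reflect_symmetric[OF uminus_box] box_cover_def .

lemma induces_ring_cover: "induces (ring_cover r origin_partition n) (agree_on (ring_box r n))"
  using induces_shift_join[OF induces_origin_partition, of "ring_box r n"]
  unfolding reflect_symmetric[OF uminus_ring_box] ring_cover_def .

section \<open>Counting traces\<close>

text \<open>The restriction fixes the values outside the space-time window, so that equality of
  traces is agreement of the orbits on \<open>D\<close> at all times below \<open>N\<close>.\<close>

definition trace :: "('a config \<Rightarrow> 'a config) \<Rightarrow> (int \<times> int) set \<Rightarrow> nat \<Rightarrow> 'a config
    \<Rightarrow> nat \<times> (int \<times> int) \<Rightarrow> 'a" where
  "trace F D N x = restrict (\<lambda>(i, u). (F ^^ i) x u) ({..<N} \<times> D)"

definition trace_count :: "('a config \<Rightarrow> 'a config) \<Rightarrow> (int \<times> int) set \<Rightarrow> nat \<Rightarrow> nat" where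
  "trace_count F D N = card (range (trace F D N))"

definition trace_entropy :: "('a config \<Rightarrow> 'a config) \<Rightarrow> (int \<times> int) set \<Rightarrow> real" where
  "trace_entropy F D = lim (\<lambda>N. ln (real (trace_count F D N)) / real N)"

lemma trace_eq_iff:
  "trace F D N x = trace F D N y \<longleftrightarrow> (\<forall>i<N. \<forall>u\<in>D. (F ^^ i) x u = (F ^^ i) y u)"
proof
  assume eq: "trace F D N x = trace F D N y"
  show "\<forall>i<N. \<forall>u\<in>D. (F ^^ i) x u = (F ^^ i) y u"
  proof (intro allI impI ballI)
    fix i u assume "i < N" "u \<in> D"
    then show "(F ^^ i) x u = (F ^^ i) y u"
      using fun_cong[OF eq, of "(i, u)"] by (simp add: trace_def)
  qed
qed (auto simp: trace_def fun_eq_iff restrict_def)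

lemma card_range_restrict:
  fixes f :: "'x \<Rightarrow> 'i \<Rightarrow> 'a::finite"
  assumes "finite I"
  shows "finite (range (\<lambda>x. restrict (f x) I))"
    and "card (range (\<lambda>x. restrict (f x) I)) \<le> CARD('a) ^ card I"
proof -
  have sub: "range (\<lambda>x. restrict (f x) I) \<subseteq> I \<rightarrow>\<^sub>E UNIV" by auto
  have fin: "finite (I \<rightarrow>\<^sub>E (UNIV :: 'a set))" using assms by (simp add: finite_PiE)
  show "finite (range (\<lambda>x. restrict (f x) I))" by (rule finite_subset[OF sub fin])
  show "card (range (\<lambda>x. restrict (f x) I)) \<le> CARD('a) ^ card I"
    using card_mono[OF fin sub] by (simp add: card_funcsetE[OF assms])
qed

lemma card_range_determined:
  assumes "finite (range g)" "\<And>x y. g x = g y \<Longrightarrow> f x = f y"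
  shows "card (range f) \<le> card (range g)"
proof -
  \<comment> \<open>\<open>inv g\<close> selects one preimage of each value of \<open>g\<close>; the
    selected point shares its \<open>g\<close>-value with \<open>x\<close>, hence also its
    \<open>f\<close>-value. Thus \<open>f\<close> factors through \<open>g\<close>.\<close>
  have "range f = (\<lambda>t. f (inv g t)) ` range g"
  proof -
    have "f x = f (inv g (g x))" for x by (rule assms(2)) (simp add: f_inv_into_f)
    then show ?thesis by (simp add: image_image)
  qed
  then show ?thesis using card_image_le[OF assms(1)] by metis
qed

lemma card_range_determined2:
  assumes "finite (range g)" "finite (range h)"
    and "\<And>x y. g x = g y \<Longrightarrow> h x = h y \<Longrightarrow> f x = f y"
  shows "card (range f) \<le> card (range g) * card (range h)"
proof -
  have sub: "range (\<lambda>x. (g x, h x)) \<subseteq> range g \<times> range h" by auto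
  have fin: "finite (range g \<times> range h)" using assms by simp
  have "card (range f) \<le> card (range (\<lambda>x. (g x, h x)))"
    by (rule card_range_determined[OF finite_subset[OF sub fin]]) (intro assms(3), simp_all)
  also have "\<dots> \<le> card (range g) * card (range h)"
    using card_mono[OF fin sub] by (simp add: card_cartesian_product)
  finally show ?thesis .
qed

lemma finite_range_trace:
  fixes F :: "('a::finite) config \<Rightarrow> 'a config"
  assumes "finite D" shows "finite (range (trace F D N))"
  unfolding trace_def using assms by (intro card_range_restrict) simp

text \<open>Up to the empty set, the join of the preimage covers is the partition of configurations
  by their traces, so a smallest subcover has one member per trace.\<close>

lemma dyn_entropy_eq_trace_entropy:
  fixes F :: "('a::finite) config \<Rightarrow> 'a config"
  assumes "induces C (agree_on D)" "finite D"
  shows "dyn_entropy C F = trace_entropy F D"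
proof -
  have "min_subcover_card (cover_join {..<N} (\<lambda>i. preimage_cover (F ^^ i) C)) = trace_count F D N"
    for N
    unfolding trace_count_def
    by (rule min_subcover_card_induces[OF induces_cover_join[OF induces_preimage_cover[OF assms(1)]]])
      (auto simp: trace_eq_iff finite_range_trace[OF assms(2)])
  then show ?thesis by (simp add: dyn_entropy_def cover_entropy_def trace_entropy_def)
qed

lemma trace_count_pos:
  fixes F :: "('a::finite) config \<Rightarrow> 'a config"
  assumes "finite D" shows "trace_count F D N > 0"
  using finite_range_trace[OF assms, of F N] by (simp add: trace_count_def card_gt_0_iff)

lemma trace_count_mono:
  fixes F :: "('a::finite) config \<Rightarrow> 'a config"
  assumes "D \<subseteq> D'" "finite D'" shows "trace_count F D N \<le> trace_count F D' N"
  unfolding trace_count_def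
  by (rule card_range_determined[OF finite_range_trace[OF assms(2)]])
    (use assms(1) in \<open>auto simp: trace_eq_iff\<close>)

text \<open>An orbit segment of length \<open>M + N\<close> splits into its first \<open>M\<close>
  steps and the first \<open>N\<close> steps of the orbit of \<open>(F ^^ M) x\<close>, whose trace
  is one of the traces of length \<open>N\<close>.\<close>

lemma trace_count_add:
  fixes F :: "('a::finite) config \<Rightarrow> 'a config"
  assumes "finite D"
  shows "trace_count F D (M + N) \<le> trace_count F D M * trace_count F D N"
proof -
  let ?g = "\<lambda>x. trace F D N ((F ^^ M) x)"
  have sub: "range ?g \<subseteq> range (trace F D N)" by auto
  note fin = finite_range_trace[OF assms]
  have "card (range (trace F D (M + N))) \<le> card (range (trace F D M)) * card (range ?g)"
  proof (rule card_range_determined2[OF fin finite_subset[OF sub fin]])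
    fix x y assume xy: "trace F D M x = trace F D M y" "?g x = ?g y"
    have "(F ^^ i) x u = (F ^^ i) y u" if "i < M + N" "u \<in> D" for i u
    proof (cases "i < M")
      case True
      with xy(1) that show ?thesis by (simp add: trace_eq_iff)
    next
      case False
      \<comment> \<open>The order \<open>j + M\<close> lets \<open>funpow_add\<close> apply
        \<open>F ^^ M\<close> first, which exposes the second segment.\<close>
      then have "i = (i - M) + M" "i - M < N" using that(1) by auto
      then obtain j where "i = j + M" "j < N" by blast
      with xy(2) that(2) show ?thesis by (simp add: trace_eq_iff funpow_add)
    qed
    then show "trace F D (M + N) x = trace F D (M + N) y" by (simp add: trace_eq_iff)
  qed
  also have "\<dots> \<le> card (range (trace F D M)) * card (range (trace F D N))"
    using card_mono[OF fin sub] by simp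
  finally show ?thesis by (simp add: trace_count_def)
qed

lemma trace_count_le:
  fixes F :: "('a::finite) config \<Rightarrow> 'a config"
  assumes "finite D" shows "trace_count F D N \<le> CARD('a) ^ (N * card D)"
proof -
  have "trace F D N = (\<lambda>x. restrict (\<lambda>(i, u). (F ^^ i) x u) ({..<N} \<times> D))"
    by (rule ext) (rule trace_def)
  moreover have "card ({..<N} \<times> D) = N * card D"
    by (simp only: card_cartesian_product card_lessThan)
  moreover have "finite ({..<N} \<times> D)"
    using assms by simp
  note card_range_restrict(2)[OF this, of "\<lambda>x (i, u). (F ^^ i) x u"]
  ultimately show ?thesis
    by (simp only: trace_count_def)
qed

section \<open>Existence and monotonicity of trace entropy\<close>

text \<open>Fekete's lemma: the limit is the infimum of the quotients. For \<open>k\<close> with a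
  nearly optimal quotient, division of \<open>n\<close> by \<open>k\<close> with remainder bounds
  \<open>a n / real n\<close> by \<open>a k / real k\<close> plus a vanishing term.\<close>

lemma Fekete_convergent:
  fixes a :: "nat \<Rightarrow> real"
  assumes nonneg: "\<And>n. a n \<ge> 0" and sub: "\<And>m n. a (m + n) \<le> a m + a n"
  shows "convergent (\<lambda>n. a n / real n)"
proof -
  define L where "L = (INF n\<in>{1..}. a n / real n)"
  have bdd: "bdd_below ((\<lambda>n. a n / real n) ` {1..})"
    by (rule bdd_belowI[of _ 0]) (use nonneg in auto)
  have "(\<lambda>n. a n / real n) \<longlonglongrightarrow> L"
  proof (rule order_tendstoI)
    fix c assume c: "c < L"
    have "L \<le> a n / real n" if "n \<ge> 1" for n
      unfolding L_def by (rule cINF_lower[OF bdd]) (use that in auto)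
    with c show "\<forall>\<^sub>F n in sequentially. c < a n / real n"
      by (intro eventually_sequentiallyI[of 1]) (meson less_le_trans)
  next
    fix c assume "L < c"
    then obtain k where k: "k \<ge> 1" "a k / real k < c"
      unfolding L_def using cINF_less_iff[OF _ bdd, of c] by auto
    \<comment> \<open>By nonnegativity this sum dominates \<open>a s\<close> for every remainder
      \<open>s < k\<close>, uniformly in \<open>n\<close>.\<close>
    define M where "M = (\<Sum>s<k. a s)"
    have mult: "a (q * k + s) \<le> real q * a k + a s" for q s
    proof (induction q)
      case (Suc q)
      have "a (Suc q * k + s) \<le> a k + a (q * k + s)" using sub[of k "q * k + s"] by (simp add: add.assoc)
      with Suc show ?case by (simp add: algebra_simps)
    qed simp
    have le: "a n / real n \<le> a k / real k + M / real n" if "n \<ge> 1" for n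
    proof -
      have "a n \<le> real (n div k) * a k + a (n mod k)"
        using mult[of "n div k" "n mod k"] by simp
      also have "a (n mod k) \<le> M"
        unfolding M_def by (rule member_le_sum) (use k nonneg in auto)
      also have "real (n div k) * a k \<le> (real n / real k) * a k"
        by (rule mult_right_mono[OF of_nat_div_le_of_nat nonneg])
      finally have "a n \<le> (real n / real k) * a k + M" by simp
      then show ?thesis using that k by (simp add: field_simps)
    qed
    have "(\<lambda>n. a k / real k + M / real n) \<longlonglongrightarrow> a k / real k + 0"
      by (intro tendsto_add tendsto_const lim_const_over_n)
    then have "\<forall>\<^sub>F n in sequentially. a k / real k + M / real n < c"
      using k(2) by (auto dest: order_tendstoD(2))
    then show "\<forall>\<^sub>F n in sequentially. a n / real n < c"
      using eventually_ge_at_top[of 1] by eventually_elim (use le in fastforce)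
  qed
  then show ?thesis by (rule convergentI)
qed

text \<open>The logarithm turns submultiplicativity of the trace counts into subadditivity, so
  Fekete's lemma shows that \<open>lim\<close> denotes a genuine limit.\<close>

lemma trace_entropy_tendsto:
  fixes F :: "('a::finite) config \<Rightarrow> 'a config"
  assumes "finite D"
  shows "(\<lambda>N. ln (real (trace_count F D N)) / real N) \<longlonglongrightarrow> trace_entropy F D"
proof -
  note pos = trace_count_pos[OF assms, of F]
  have "convergent (\<lambda>N. ln (real (trace_count F D N)) / real N)"
  proof (rule Fekete_convergent)
    show "0 \<le> ln (real (trace_count F D n))" for n
      using pos[of n] by (simp add: Suc_leI)
    show "ln (real (trace_count F D (m + n)))
        \<le> ln (real (trace_count F D m)) + ln (real (trace_count F D n))" for m n
    proof -
      have "ln (real (trace_count F D (m + n)))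
          \<le> ln (real (trace_count F D m * trace_count F D n))"
        using trace_count_add[OF assms, of F m n] pos[of "m + n"] by (subst ln_le_cancel_iff) (simp_all add: pos del: of_nat_mult)
      then show ?thesis using pos[of m] pos[of n] by (simp add: ln_mult)
    qed
  qed
  then show ?thesis unfolding trace_entropy_def by (simp add: convergent_LIMSEQ_iff)
qed

lemma trace_entropy_mono:
  fixes F :: "('a::finite) config \<Rightarrow> 'a config"
  assumes "D \<subseteq> D'" "finite D'"
  shows "trace_entropy F D \<le> trace_entropy F D'"
proof (rule LIMSEQ_le[OF trace_entropy_tendsto trace_entropy_tendsto])
  show fin: "finite D" "finite D'" using assms finite_subset by auto
  show "\<exists>N0. \<forall>N\<ge>N0. ln (real (trace_count F D N)) / real N \<le> ln (real (trace_count F D' N)) / real N"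
    using trace_count_mono[OF assms, of F] trace_count_pos[of _ F] fin
    by (intro exI allI impI divide_right_mono) auto
qed

lemma trace_entropy_nonneg:
  fixes F :: "('a::finite) config \<Rightarrow> 'a config"
  assumes "finite D" shows "0 \<le> trace_entropy F D"
proof (rule LIMSEQ_le_const[OF trace_entropy_tendsto[OF assms]])
  show "\<exists>N0. \<forall>N\<ge>N0. 0 \<le> ln (real (trace_count F D N)) / real N"
    using trace_count_pos[OF assms, of F] by (simp add: Suc_leI)
qed

text \<open>The space-time window has \<open>N * card D\<close> entries, and the factor
  \<open>N\<close> cancels against the normalisation.\<close>

lemma trace_entropy_le:
  fixes F :: "('a::finite) config \<Rightarrow> 'a config"
  assumes "finite D" shows "trace_entropy F D \<le> real (card D) * ln (real CARD('a))"
proof (rule LIMSEQ_le_const2[OF trace_entropy_tendsto[OF assms]])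
  have "ln (real (trace_count F D N)) / real N \<le> real (card D) * ln (real CARD('a))"
    if "N \<ge> 1" for N
  proof -
    have "ln (real (trace_count F D N)) \<le> ln (real (CARD('a) ^ (N * card D)))"
      using trace_count_le[OF assms, of F N] trace_count_pos[OF assms, of F N]
      by (subst ln_le_cancel_iff) (simp_all del: of_nat_power)
    also have "\<dots> = real N * (real (card D) * ln (real CARD('a)))"
      by (simp add: ln_realpow)
    finally show ?thesis using that by (simp add: field_simps)
  qed
  then show "\<exists>N0. \<forall>N\<ge>N0. ln (real (trace_count F D N)) / real N
      \<le> real (card D) * ln (real CARD('a))" by blast
qed

section \<open>Boxes and rings\<close>

lemma finite_box [simp]: "finite (box n)"
  by (simp add: box_def)

lemma finite_ring_box [simp]: "finite (ring_box r n)"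
  by (simp add: ring_box_def)

lemma box_mono: "m \<le> n \<Longrightarrow> box m \<subseteq> box n"
  by (auto simp: box_def)

lemma card_box: "card (box n) = (2 * n + 1)\<^sup>2"
  by (simp add: box_def card_cartesian_product power2_eq_square nat_add_distrib nat_mult_distrib)

text \<open>The difference of the two squares is \<open>4 * r * (2 * n - r + 1)\<close>. For
  \<open>r \<ge> 1\<close> the last factor is at most \<open>2 * n\<close>; for \<open>r = 0\<close>
  both sides vanish, hence the case distinction.\<close>

lemma card_ring_box_le:
  assumes "r \<le> n" shows "card (ring_box r n) \<le> 8 * r * n"
proof -
  have "card (ring_box r n) = (2 * n + 1)\<^sup>2 - (2 * (n - r) + 1)\<^sup>2"
    unfolding ring_box_def by (subst card_Diff_subset) (auto simp: card_box box_mono)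
  moreover obtain m where n: "n = m + r" using assms le_iff_add by (metis add.commute)
  moreover have "(2 * (m + r) + 1)\<^sup>2 \<le> (2 * m + 1)\<^sup>2 + 8 * r * (m + r)"
    by (cases r) (auto simp: power2_eq_square algebra_simps)
  ultimately show ?thesis by simp
qed

section \<open>Entropy of boxes and of their rings\<close>

lemma has_radius_agree:
  assumes "has_radius F r" "r \<le> n" "agree_on (box n) x y"
  shows "agree_on (box (n - r)) (F x) (F y)"
proof
  fix z assume z: "z \<in> box (n - r)"
  obtain f where f: "\<And>x z. F x z = f (restrict (\<lambda>u. x (z + u)) (box r))"
    using assms(1) unfolding has_radius_def by blast
  have "z + u \<in> box n" if "u \<in> box r" for u
    using z that assms(2) by (cases z; cases u) (auto simp: box_def)
  then have "restrict (\<lambda>u. x (z + u)) (box r) = restrict (\<lambda>u. y (z + u)) (box r)"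
    using assms(3) by (intro restrict_ext) blast
  then show "F x z = F y z" by (simp add: f)
qed

text \<open>Induction on time: agreement on the box passes to the inner box one step later by
  locality, and the ring trace supplies the remaining cells. The initial pattern starts the
  induction and costs a factor free of \<open>N\<close>.\<close>

lemma trace_count_box_le:
  fixes F :: "('a::finite) config \<Rightarrow> 'a config"
  assumes "has_radius F r" "r \<le> n"
  shows "trace_count F (box n) N \<le> trace_count F (ring_box r n) N * CARD('a) ^ card (box n)"
proof -
  have "card (range (trace F (box n) N))
      \<le> card (range (trace F (ring_box r n) N)) * card (range (\<lambda>x::'a config. restrict x (box n)))"
  proof (rule card_range_determined2)
    show "finite (range (trace F (ring_box r n) N))" by (simp add: finite_range_trace)
    show "finite (range (\<lambda>x::'a config. restrict x (box n)))" by (simp add: card_range_restrict(1))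
    fix x y :: "'a config"
    assume ring: "trace F (ring_box r n) N x = trace F (ring_box r n) N y"
      and init: "restrict x (box n) = restrict y (box n)"
    have "agree_on (box n) ((F ^^ i) x) ((F ^^ i) y)" if "i < N" for i
      using that
    proof (induction i)
      case 0
      show ?case using init by simp (metis restrict_apply')
    next
      case (Suc i)
      then have "agree_on (box (n - r)) ((F ^^ Suc i) x) ((F ^^ Suc i) y)"
        using has_radius_agree[OF assms] by simp
      moreover have "agree_on (ring_box r n) ((F ^^ Suc i) x) ((F ^^ Suc i) y)"
        using ring Suc.prems unfolding trace_eq_iff by blast
      ultimately show ?case unfolding ring_box_def by blast
    qed
    then show "trace F (box n) N x = trace F (box n) N y" by (simp add: trace_eq_iff)
  qed
  also have "\<dots> \<le> card (range (trace F (ring_box r n) N)) * CARD('a) ^ card (box n)"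
    using card_range_restrict(2)[of "box n" "\<lambda>x::'a config. x"] by simp
  finally show ?thesis by (simp add: trace_count_def)
qed

text \<open>The factor for the initial pattern becomes the additive constant \<open>K\<close> under
  the logarithm and disappears after division by \<open>N\<close>. The converse inequality is
  monotonicity.\<close>

lemma trace_entropy_box_eq_ring:
  fixes F :: "('a::finite) config \<Rightarrow> 'a config"
  assumes "has_radius F r" "r \<le> n"
  shows "trace_entropy F (box n) = trace_entropy F (ring_box r n)"
proof (rule antisym)
  let ?c = "trace_count F"
  define K where "K = ln (real (CARD('a) ^ card (box n)))"
  have "ln (real (?c (box n) N)) / real N \<le> ln (real (?c (ring_box r n) N)) / real N + K / real N"
    for N
  proof -
    have "ln (real (?c (box n) N))
        \<le> ln (real (?c (ring_box r n) N * CARD('a) ^ card (box n)))"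
      using trace_count_box_le[OF assms, of N] trace_count_pos[of _ F N]
      by (subst ln_le_cancel_iff) (simp_all del: of_nat_power of_nat_mult)
    also have "\<dots> = ln (real (?c (ring_box r n) N)) + K"
      using trace_count_pos[of "ring_box r n" F N] unfolding K_def of_nat_mult
      by (subst ln_mult) simp_all
    finally show ?thesis by (simp add: add_divide_distrib[symmetric] divide_right_mono)
  qed
  moreover have "(\<lambda>N. ln (real (?c (ring_box r n) N)) / real N + K / real N)
      \<longlonglongrightarrow> trace_entropy F (ring_box r n) + 0"
    by (intro tendsto_add trace_entropy_tendsto lim_const_over_n) simp
  ultimately show "trace_entropy F (box n) \<le> trace_entropy F (ring_box r n)"
    using LIMSEQ_le[OF trace_entropy_tendsto[of "box n" F]] by fastforce
  show "trace_entropy F (ring_box r n) \<le> trace_entropy F (box n)"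
    by (rule trace_entropy_mono) (auto simp: ring_box_def)
qed

section \<open>Entropy rates of the covers by boxes\<close>

lemma ring_cover_box_cover_cells:
  obtains D where "induces (ring_cover r (box_cover origin_partition k) n) (agree_on D)"
    and "ring_box r n \<subseteq> D" "D \<subseteq> box (n + k)"
proof
  \<comment> \<open>By symmetry of the ring, these are the cells at distance at most
    \<open>k\<close> from it in the maximum norm.\<close>
  let ?D = "\<Union>v\<in>ring_box r n. (\<lambda>u. u - v) ` box k"
  show "induces (ring_cover r (box_cover origin_partition k) n) (agree_on ?D)"
    unfolding ring_cover_def by (rule induces_shift_join[OF induces_box_cover])
  show "ring_box r n \<subseteq> ?D"
  proof
    fix v assume "v \<in> ring_box r n"
    then have "- v \<in> ring_box r n" using uminus_ring_box by blast
    moreover have "0 \<in> box k" by (simp add: box_def zero_prod_def)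
    \<comment> \<open>The cell \<open>v\<close> arises from the centre of \<open>box k\<close> at
      the reflected index \<open>- v\<close>.\<close>
    moreover have "v = 0 - (- v)" by simp
    ultimately show "v \<in> ?D" by blast
  qed
  show "?D \<subseteq> box (n + k)" by (auto simp: ring_box_def box_def)
qed

text \<open>Because \<open>h\<close> grows at most linearly, dividing \<open>h (n + k)\<close> by
  \<open>n\<close> instead of \<open>n + k\<close> costs at most \<open>B * real k / real n\<close>,
  which tends to zero; the limit superior ignores the remaining index shift.\<close>

lemma limsup_ereal_sandwich_shift:
  fixes h q :: "nat \<Rightarrow> real"
  assumes bounds: "\<And>n. n \<ge> m \<Longrightarrow> h n \<le> q n \<and> q n \<le> h (n + k)"
    and h: "\<And>n. n \<ge> m \<Longrightarrow> 0 \<le> h n \<and> h n \<le> B * real n"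
  shows "limsup (\<lambda>n. ereal (q n / real n)) = limsup (\<lambda>n. ereal (h n / real n))"
proof (rule antisym)
  \<comment> \<open>The \<open>1\<close> in \<open>max m 1\<close> keeps the denominators
    positive.\<close>
  have upper: "q n / real n \<le> B * real k / real n + h (n + k) / real (n + k)"
    if n: "n \<ge> max m 1" for n
  proof -
    have "h (n + k) / real n - h (n + k) / real (n + k)
        = h (n + k) * real k / (real n * real (n + k))"
      using n by (simp add: field_simps)
    also have "\<dots> \<le> B * real (n + k) * real k / (real n * real (n + k))"
      using h[of "n + k"] n by (intro divide_right_mono mult_right_mono) auto
    also have "\<dots> = B * real k / real n"
    proof -
      have "real (n + k) \<noteq> 0" using n by simp
      then show ?thesis by (simp add: field_simps del: of_nat_add)
    qed
    finally have "h (n + k) / real n \<le> B * real k / real n + h (n + k) / real (n + k)" by simp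
    moreover have "q n / real n \<le> h (n + k) / real n"
      using bounds[of n] n by (simp add: divide_right_mono)
    ultimately show ?thesis by linarith
  qed
  have "limsup (\<lambda>n. ereal (q n / real n))
      \<le> limsup (\<lambda>n. ereal (B * real k / real n) + ereal (h (n + k) / real (n + k)))"
    by (rule Limsup_mono) (use upper in \<open>auto intro!: eventually_sequentiallyI[of "max m 1"]\<close>)
  \<comment> \<open>The first summand converges, so the limit superior of the sum splits with
    equality.\<close>
  also have "\<dots> = 0 + limsup (\<lambda>n. ereal (h (n + k) / real (n + k)))"
    by (rule ereal_limsup_lim_add)
      (use lim_const_over_n[of "B * real k"] in \<open>simp_all add: zero_ereal_def\<close>)
  also have "\<dots> = limsup (\<lambda>n. ereal (h n / real n))"
    using limsup_shift_k[of "\<lambda>n. ereal (h n / real n)" k] by simp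
  finally show "limsup (\<lambda>n. ereal (q n / real n)) \<le> limsup (\<lambda>n. ereal (h n / real n))" .
  show "limsup (\<lambda>n. ereal (h n / real n)) \<le> limsup (\<lambda>n. ereal (q n / real n))"
    by (rule Limsup_mono)
      (use bounds in \<open>auto intro!: eventually_sequentiallyI[of m] divide_right_mono\<close>)
qed

theorem proposition12:
  fixes F :: "('a::finite) config \<Rightarrow> 'a config" and r :: nat
  assumes "cellular_automaton F" and "has_radius F r"
  shows "(\<forall>n\<ge>r. dyn_entropy (box_cover origin_partition n) F
                 = dyn_entropy (ring_cover r origin_partition n) F)
       \<and> (\<forall>n. entropy_rate r (box_cover origin_partition n) F
              = entropy_rate r origin_partition F)
       \<and> (\<forall>k. entropy_rate r (box_cover origin_partition k) F
              = entropy_rate r origin_partition F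
            \<and> entropy_rate r origin_partition F
              \<le> ereal (8 * real r * ln (real CARD('a))))"
proof -
  let ?h = "\<lambda>n. trace_entropy F (ring_box r n)" and ?B = "8 * real r * ln (real CARD('a))"
  have box: "dyn_entropy (box_cover origin_partition n) F = trace_entropy F (box n)" for n
    by (intro dyn_entropy_eq_trace_entropy induces_box_cover) simp
  have ring: "dyn_entropy (ring_cover r origin_partition n) F = ?h n" for n
    by (intro dyn_entropy_eq_trace_entropy induces_ring_cover) simp
  have ring_bound: "0 \<le> ?h n \<and> ?h n \<le> ?B * real n" if "n \<ge> r" for n
  proof
    have "?h n \<le> real (card (ring_box r n)) * ln (real CARD('a))"
      by (rule trace_entropy_le) simp
    \<comment> \<open>The alphabet is nonempty, so the logarithm is nonnegative and the cell count
      may be enlarged.\<close>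
    also have "\<dots> \<le> real (8 * r * n) * ln (real CARD('a))"
      using card_ring_box_le[OF that] by (intro mult_right_mono of_nat_mono) (simp_all add: Suc_leI)
    finally show "?h n \<le> ?B * real n" by (simp add: mult_ac)
  qed (simp add: trace_entropy_nonneg)
  have rate: "entropy_rate r (box_cover origin_partition k) F = entropy_rate r origin_partition F"
    for k
    unfolding entropy_rate_def ring
  \<comment> \<open>The upper estimate goes through \<open>box (n + k)\<close>, whose entropy is
    that of its own ring because \<open>n + k \<ge> r\<close>.\<close>
  proof (rule limsup_ereal_sandwich_shift[OF _ ring_bound])
    fix n assume n: "n \<ge> r"
    obtain D where D: "induces (ring_cover r (box_cover origin_partition k) n) (agree_on D :: 'a config \<Rightarrow> _)"
      "ring_box r n \<subseteq> D" "D \<subseteq> box (n + k)"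
      by (rule ring_cover_box_cover_cells)
    have fin: "finite D" using D(3) by (rule finite_subset) simp
    show "?h n \<le> dyn_entropy (ring_cover r (box_cover origin_partition k) n) F \<and>
        dyn_entropy (ring_cover r (box_cover origin_partition k) n) F \<le> ?h (n + k)"
      unfolding dyn_entropy_eq_trace_entropy[OF D(1) fin]
      using trace_entropy_mono[OF D(2) fin, of F] trace_entropy_mono[OF D(3), of F]
        trace_entropy_box_eq_ring[OF assms(2), of "n + k"] n by simp
  qed
  have "entropy_rate r origin_partition F \<le> ereal ?B"
    unfolding entropy_rate_def ring
  \<comment> \<open>\<open>ring_bound\<close> requires \<open>n \<ge> r\<close>, and the division
    requires \<open>n > 0\<close>.\<close>
  proof (rule Limsup_bounded, rule eventually_sequentiallyI[of "max r 1"])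
    fix n assume "max r 1 \<le> n"
    then show "ereal (?h n / real n) \<le> ereal ?B"
      using ring_bound[of n] by (simp add: divide_le_eq)
  qed
  with rate show ?thesis
    using box ring trace_entropy_box_eq_ring[OF assms(2)] by simp
qed

end
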